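(* Let $\mathbf F$ be an infinite spherically complete field with a nontrivial non-Archimedean valuation, let $E,H,G$ be normed spaces over $\mathbf F$, and $1\le r\le\infty$. If $T\in L(E,H)$ and $S\in L_r(H,G)$, then $ST\in L_r(E,G)$ and $\nu_r(ST)\le\nu_r(S)\|T\|$. If $T\in L_r(E,H)$ and $S\in L(H,G)$, then $ST\in L_r(E,G)$ and $\nu_r(ST)\le\|S\|\nu_r(T)$.
   Context: $L(E,H)$ is the space of bounded linear operators with the operator norm. For $1\le r<\infty$, $L_r(E,H)$ is the set of $A\in L(E,H)$ of the form $Ax=\sum_{n=1}^\infty a_n(x)y_n$ for all $x\in E$, with $a_n\in E^*$, $y_n\in H$ and $\sum_{n=1}^\infty\|a_n\|_{E^*}^r\|y_n\|_H^r<\infty$, and $\nu_r(A)=\inf\{\sum_n\|a_n\|^r_{E^*}\|y_n\|_H^r\}^{1/r}$ over all such representations; $L_\infty(E,H):=L(E,H)$ and $\nu_\infty(A)=\|A\|$. *)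

theory Defs
  imports Complex_Main "HOL-Library.Extended_Real"
begin

text \<open>Valuations are written multiplicatively, i.e. as absolute values.\<close>

locale nonarch_valued_field =
  fixes val :: "'f::field \<Rightarrow> real"
  assumes val_nonneg: "0 \<le> val a"
    and val_eq_0_iff: "val a = 0 \<longleftrightarrow> a = 0"
    and val_mult: "val (a * b) = val a * val b"
    and val_add_le_max: "val (a + b) \<le> max (val a) (val b)"

definition nontrivial_valuation :: "('f::field \<Rightarrow> real) \<Rightarrow> bool" where
  "nontrivial_valuation val \<longleftrightarrow> (\<exists>a. a \<noteq> 0 \<and> val a \<noteq> 1)"

definition val_cball :: "('f::field \<Rightarrow> real) \<Rightarrow> 'f \<Rightarrow> real \<Rightarrow> 'f set" where
  "val_cball val c \<rho> = {a. val (a - c) \<le> \<rho>}"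

definition spherically_complete :: "('f::field \<Rightarrow> real) \<Rightarrow> bool" where
  "spherically_complete val \<longleftrightarrow>
    (\<forall>c \<rho>. (\<forall>n::nat. 0 < \<rho> n) \<and>
       (\<forall>n. val_cball val (c (Suc n)) (\<rho> (Suc n)) \<subseteq> val_cball val (c n) (\<rho> n))
       \<longrightarrow> (\<Inter>n. val_cball val (c n) (\<rho> n)) \<noteq> {})"

text \<open>
  Only the ordinary triangle inequality is demanded of a norm; ultrametric norms, which
  many authors require over a non-Archimedean field, are included as a special case.
\<close>

locale valued_normed_space =
  nonarch_valued_field val + vector_space scale
  for val :: "'f::field \<Rightarrow> real"
    and scale :: "'f \<Rightarrow> 'v::ab_group_add \<Rightarrow> 'v" +
  fixes nrm :: "'v \<Rightarrow> real"
  assumes nrm_nonneg: "0 \<le> nrm x"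
    and nrm_eq_0_iff: "nrm x = 0 \<longleftrightarrow> x = 0"
    and nrm_scale: "nrm (scale c x) = val c * nrm x"
    and nrm_triangle: "nrm (x + y) \<le> nrm x + nrm y"

definition bounded_operators ::
  "('f::field \<Rightarrow> 'e::ab_group_add \<Rightarrow> 'e) \<Rightarrow> ('e \<Rightarrow> real) \<Rightarrow>
   ('f \<Rightarrow> 'h::ab_group_add \<Rightarrow> 'h) \<Rightarrow> ('h \<Rightarrow> real) \<Rightarrow> ('e \<Rightarrow> 'h) set" where
  "bounded_operators sE nE sH nH =
    {A. Vector_Spaces.linear sE sH A \<and> (\<exists>C. \<forall>x. nH (A x) \<le> C * nE x)}"

text \<open>
  As for \<^const>\<open>inverse\<close>, division by zero gives zero, so \<open>x = 0\<close> contributes the value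
  \<open>0\<close> and the supremum is the one over \<open>x \<noteq> 0\<close> (and \<open>0\<close> on the zero space).  The
  supremum over the closed unit ball would in general be a different number, because a
  vector need not have a multiple of norm one.
\<close>

definition op_norm :: "('e \<Rightarrow> real) \<Rightarrow> ('h \<Rightarrow> real) \<Rightarrow> ('e \<Rightarrow> 'h) \<Rightarrow> real" where
  "op_norm nE nH A = (SUP x. nH (A x) / nE x)"

text \<open>The dual of \<open>E\<close>; the field is a normed space over itself with norm \<open>val\<close>.\<close>

definition bounded_dual ::
  "('f::field \<Rightarrow> real) \<Rightarrow> ('f \<Rightarrow> 'e::ab_group_add \<Rightarrow> 'e) \<Rightarrow> ('e \<Rightarrow> real) \<Rightarrow> ('e \<Rightarrow> 'f) set" where
  "bounded_dual val sE nE = bounded_operators sE nE (*) val"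

definition represents ::
  "('f::field \<Rightarrow> real) \<Rightarrow> ('f \<Rightarrow> 'e::ab_group_add \<Rightarrow> 'e) \<Rightarrow> ('e \<Rightarrow> real) \<Rightarrow>
   ('f \<Rightarrow> 'h::ab_group_add \<Rightarrow> 'h) \<Rightarrow> ('h \<Rightarrow> real) \<Rightarrow> real \<Rightarrow>
   (nat \<Rightarrow> 'e \<Rightarrow> 'f) \<Rightarrow> (nat \<Rightarrow> 'h) \<Rightarrow> ('e \<Rightarrow> 'h) \<Rightarrow> bool" where
  "represents val sE nE sH nH p a y A \<longleftrightarrow>
    (\<forall>n. a n \<in> bounded_dual val sE nE) \<and>
    (\<forall>x. (\<lambda>N. nH ((\<Sum>n<N. sH (a n x) (y n)) - A x)) \<longlonglongrightarrow> 0) \<and>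
    summable (\<lambda>n. op_norm nE val (a n) powr p * nH (y n) powr p)"

definition L_class ::
  "ereal \<Rightarrow> ('f::field \<Rightarrow> real) \<Rightarrow> ('f \<Rightarrow> 'e::ab_group_add \<Rightarrow> 'e) \<Rightarrow> ('e \<Rightarrow> real) \<Rightarrow>
   ('f \<Rightarrow> 'h::ab_group_add \<Rightarrow> 'h) \<Rightarrow> ('h \<Rightarrow> real) \<Rightarrow> ('e \<Rightarrow> 'h) set" where
  "L_class r val sE nE sH nH =
    (if r = \<infinity> then bounded_operators sE nE sH nH
     else {A \<in> bounded_operators sE nE sH nH.
            \<exists>a y. represents val sE nE sH nH (real_of_ereal r) a y A})"

definition nu ::
  "ereal \<Rightarrow> ('f::field \<Rightarrow> real) \<Rightarrow> ('f \<Rightarrow> 'e::ab_group_add \<Rightarrow> 'e) \<Rightarrow> ('e \<Rightarrow> real) \<Rightarrow>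
   ('f \<Rightarrow> 'h::ab_group_add \<Rightarrow> 'h) \<Rightarrow> ('h \<Rightarrow> real) \<Rightarrow> ('e \<Rightarrow> 'h) \<Rightarrow> real" where
  "nu r val sE nE sH nH A =
    (if r = \<infinity> then op_norm nE nH A
     else Inf {(\<Sum>n. op_norm nE val (a n) powr real_of_ereal r * nH (y n) powr real_of_ereal r)
                 powr (1 / real_of_ereal r)
               | a y. represents val sE nE sH nH (real_of_ereal r) a y A})"

end

theory Submission imports Defs begin

text \<open>
  A representation \<open>S x = \<Sum>n. a n x *\<^sub>G y n\<close> can be composed with a bounded operator termwise:
  \<open>S \<circ> T\<close> is represented by the functionals \<open>a n \<circ> T\<close> and the same vectors \<open>y n\<close>, and, if \<open>T\<close>
  is represented by \<open>a\<close> and \<open>y\<close>, then \<open>S \<circ> T\<close> is represented by the same functionals \<open>a n\<close> and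
  the vectors \<open>S (y n)\<close>, since \<open>S\<close> is linear and continuous.  Submultiplicativity of the operator
  norm bounds each product \<open>\<parallel>a n\<parallel> * \<parallel>y n\<parallel>\<close> of the new representation by \<open>c\<close> times the old one,
  where \<open>c\<close> is the norm of the bounded factor.  So the \<open>r\<close>-norm of the sequence of products
  grows at most by the factor \<open>c\<close> (\<open>represents_rescaled\<close>), and taking infima over all
  representations gives the claim for finite \<open>r\<close> (\<open>nu_le_if_representations_transfer\<close>).
  For \<open>r = \<infinity>\<close> the claim is submultiplicativity itself (\<open>op_norm_compose\<close>).
\<close>

section \<open>The operator norm over a valued field\<close>

lemma (in nonarch_valued_field) field_valued_normed_space:
  "valued_normed_space val (*) val"
proof unfold_locales
  show "val (x + y) \<le> val x + val y" for x y
    using val_add_le_max[of x y] val_nonneg[of x] val_nonneg[of y] by linarith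
qed (auto simp: val_nonneg val_eq_0_iff val_mult algebra_simps)

lemma bounded_operators_linear:
  "A \<in> bounded_operators sE nE sH nH \<Longrightarrow> Vector_Spaces.linear sE sH A"
  by (simp add: bounded_operators_def)

lemma bounded_operators_zero:
  "A \<in> bounded_operators sE nE sH nH \<Longrightarrow> A 0 = 0"
  by (rule module_hom.zero[OF Vector_Spaces.linear.axioms(3)[OF bounded_operators_linear]])

lemma op_norm_upper:
  assumes E: "valued_normed_space val sE nE" and A: "A \<in> bounded_operators sE nE sH nH"
  shows "nH (A x) / nE x \<le> op_norm nE nH A"
proof -
  interpret E: valued_normed_space val sE nE by (rule E)
  obtain C where C: "\<And>x. nH (A x) \<le> C * nE x"
    using A by (auto simp: bounded_operators_def)
  \<comment> \<open>The quotient is \<open>0\<close> at \<open>x = 0\<close>, and on the zero space \<open>C\<close> may be negative.\<close>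
  have "nH (A x) / nE x \<le> max C 0" for x
  proof (cases "nE x = 0")
    case False
    then have "0 < nE x" using E.nrm_nonneg[of x] by linarith
    then have "nH (A x) / nE x \<le> C"
      using C[of x] by (simp add: divide_le_eq)
    then show ?thesis by simp
  qed simp
  then have "bdd_above (range (\<lambda>x. nH (A x) / nE x))" by (intro bdd_aboveI2)
  then show ?thesis unfolding op_norm_def by (rule cSUP_upper[OF UNIV_I])
qed

lemma op_norm_nonneg:
  assumes "valued_normed_space val sE nE" and "A \<in> bounded_operators sE nE sH nH"
  shows "0 \<le> op_norm nE nH A"
proof -
  have "nE 0 = 0" using valued_normed_space.nrm_eq_0_iff[OF assms(1)] by blast
  then show ?thesis using op_norm_upper[OF assms, of 0] by simp
qed

lemma norm_apply_le_op_norm: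
  assumes E: "valued_normed_space val sE nE" and H: "valued_normed_space val sH nH"
    and A: "A \<in> bounded_operators sE nE sH nH"
  shows "nH (A x) \<le> op_norm nE nH A * nE x"
proof (cases "x = 0")
  case True
  have "nE 0 = 0" "nH 0 = 0"
    using valued_normed_space.nrm_eq_0_iff[OF E] valued_normed_space.nrm_eq_0_iff[OF H] by blast+
  then show ?thesis using True bounded_operators_zero[OF A] by simp
next
  case False
  then have "0 < nE x"
    using valued_normed_space.nrm_eq_0_iff[OF E] valued_normed_space.nrm_nonneg[OF E, of x]
    by (simp add: less_le)
  then show ?thesis using op_norm_upper[OF E A, of x] by (simp add: divide_le_eq)
qed

lemma op_norm_least:
  assumes "valued_normed_space val sE nE" and "0 \<le> C" and "\<And>x. nH (A x) \<le> C * nE x"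
  shows "op_norm nE nH A \<le> C"
  unfolding op_norm_def
proof (rule cSUP_least)
  show "nH (A x) / nE x \<le> C" for x
    using assms(2) assms(3)[of x] valued_normed_space.nrm_nonneg[OF assms(1), of x]
    by (cases "nE x = 0") (simp_all add: divide_le_eq less_le)
qed simp

lemma norm_compose_le_op_norms:
  assumes "valued_normed_space val sE nE" and H: "valued_normed_space val sH nH"
    and G: "valued_normed_space val sG nG"
    and "T \<in> bounded_operators sE nE sH nH" and S: "S \<in> bounded_operators sH nH sG nG"
  shows "nG ((S \<circ> T) x) \<le> (op_norm nH nG S * op_norm nE nH T) * nE x"
proof -
  have "nG (S (T x)) \<le> op_norm nH nG S * nH (T x)"
    by (rule norm_apply_le_op_norm[OF H G S])
  also have "\<dots> \<le> op_norm nH nG S * (op_norm nE nH T * nE x)"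
    using assms by (intro mult_left_mono norm_apply_le_op_norm op_norm_nonneg[OF H S])
  finally show ?thesis by (simp add: mult.assoc)
qed

lemma bounded_operators_compose:
  assumes "valued_normed_space val sE nE" and "valued_normed_space val sH nH"
    and "valued_normed_space val sG nG"
    and "T \<in> bounded_operators sE nE sH nH" and "S \<in> bounded_operators sH nH sG nG"
  shows "S \<circ> T \<in> bounded_operators sE nE sG nG"
proof -
  have "Vector_Spaces.linear sE sG (S \<circ> T)"
    by (rule Vector_Spaces.linear_compose)
      (use assms in \<open>auto intro: bounded_operators_linear\<close>)
  then show ?thesis
    using norm_compose_le_op_norms[OF assms] unfolding bounded_operators_def by blast
qed

lemma op_norm_compose:
  assumes "valued_normed_space val sE nE" and "valued_normed_space val sH nH"
    and "valued_normed_space val sG nG"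
    and "T \<in> bounded_operators sE nE sH nH" and "S \<in> bounded_operators sH nH sG nG"
  shows "op_norm nE nG (S \<circ> T) \<le> op_norm nH nG S * op_norm nE nH T"
  using norm_compose_le_op_norms[OF assms]
  by (intro op_norm_least[OF assms(1)] mult_nonneg_nonneg op_norm_nonneg[OF assms(2,5)]
      op_norm_nonneg[OF assms(1,4)])

section \<open>Composing representations\<close>

lemma op_norm_dual_nonneg:
  assumes "valued_normed_space val sE nE" and "a \<in> bounded_dual val sE nE"
  shows "0 \<le> op_norm nE val a"
  using assms(2) unfolding bounded_dual_def by (rule op_norm_nonneg[OF assms(1)])

text \<open>
  The weights enter only through the products \<open>\<parallel>a n\<parallel> * \<parallel>y n\<parallel>\<close>, because
  \<open>s powr p * t powr p = (s * t) powr p\<close>; so it is enough to compare these products, whichever of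
  the two factors an operator has been absorbed into.  The factor \<open>c powr p\<close> that comes out of the
  sum becomes \<open>c\<close> under the final root.
\<close>

lemma represents_rescaled:
  assumes E: "valued_normed_space val sE nE" and H: "valued_normed_space val sH nH"
    and E': "valued_normed_space val sE' nE'" and H': "valued_normed_space val sH' nH'"
    and p: "0 < p" and c: "0 \<le> c"
    and rep: "represents val sE nE sH nH p a y A"
    and dual: "\<And>n. b n \<in> bounded_dual val sE' nE'"
    and conv: "\<And>x. (\<lambda>N. nH' ((\<Sum>n<N. sH' (b n x) (z n)) - B x)) \<longlonglongrightarrow> 0"
    and le: "\<And>n. op_norm nE' val (b n) * nH' (z n) \<le> c * (op_norm nE val (a n) * nH (y n))"
  shows "represents val sE' nE' sH' nH' p b z B"
    and "(\<Sum>n. op_norm nE' val (b n) powr p * nH' (z n) powr p) powr (1 / p)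
         \<le> c * (\<Sum>n. op_norm nE val (a n) powr p * nH (y n) powr p) powr (1 / p)"
proof -
  let ?w = "\<lambda>n. op_norm nE val (a n) powr p * nH (y n) powr p"
  let ?w' = "\<lambda>n. op_norm nE' val (b n) powr p * nH' (z n) powr p"
  have nonneg: "0 \<le> op_norm nE val (a n)" "0 \<le> nH (y n)"
      "0 \<le> op_norm nE' val (b n)" "0 \<le> nH' (z n)" for n
    using rep dual op_norm_dual_nonneg[OF E] op_norm_dual_nonneg[OF E']
    by (auto simp: represents_def valued_normed_space.nrm_nonneg[OF H]
        valued_normed_space.nrm_nonneg[OF H'])
  have summ: "summable ?w" using rep by (simp add: represents_def)
  have w_le: "?w' n \<le> c powr p * ?w n" for n
  proof -
    have "?w' n = (op_norm nE' val (b n) * nH' (z n)) powr p"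
      by (simp add: powr_mult nonneg)
    also have "\<dots> \<le> (c * (op_norm nE val (a n) * nH (y n))) powr p"
      using le p by (intro powr_mono2) (auto simp: nonneg)
    also have "\<dots> = c powr p * ?w n"
      by (simp add: powr_mult nonneg c)
    finally show ?thesis .
  qed
  have summ': "summable ?w'"
    by (rule summable_comparison_test'[OF summable_mult[OF summ, of "c powr p"], of 0])
      (use w_le in simp)
  then show "represents val sE' nE' sH' nH' p b z B"
    using dual conv by (simp add: represents_def)
  have "suminf ?w' \<le> (\<Sum>n. c powr p * ?w n)"
    by (intro suminf_le w_le summ' summable_mult summ)
  also have "\<dots> = c powr p * suminf ?w" by (rule suminf_mult[OF summ])
  finally have "suminf ?w' powr (1 / p) \<le> (c powr p * suminf ?w) powr (1 / p)"
    using p by (intro powr_mono2) (auto intro: suminf_nonneg summ')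
  also have "\<dots> = c * suminf ?w powr (1 / p)"
    using p c suminf_nonneg[OF summ] by (simp add: powr_mult powr_powr)
  finally show "suminf ?w' powr (1 / p) \<le> c * suminf ?w powr (1 / p)" .
qed

lemma represents_precompose:
  assumes E: "valued_normed_space val sE nE" and H: "valued_normed_space val sH nH"
    and G: "valued_normed_space val sG nG" and p: "0 < p"
    and T: "T \<in> bounded_operators sE nE sH nH"
    and rep: "represents val sH nH sG nG p a y S"
  shows "represents val sE nE sG nG p (\<lambda>n. a n \<circ> T) y (S \<circ> T)"
    and "(\<Sum>n. op_norm nE val (a n \<circ> T) powr p * nG (y n) powr p) powr (1 / p)
         \<le> op_norm nE nH T * (\<Sum>n. op_norm nH val (a n) powr p * nG (y n) powr p) powr (1 / p)"
proof -
  interpret H: valued_normed_space val sH nH by (rule H)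
  note F = H.field_valued_normed_space
  have a: "a n \<in> bounded_operators sH nH (*) val" for n
    using rep by (simp add: represents_def bounded_dual_def)
  have dual: "a n \<circ> T \<in> bounded_dual val sE nE" for n
    unfolding bounded_dual_def by (rule bounded_operators_compose[OF E H F T a])
  have conv: "(\<lambda>N. nG ((\<Sum>n<N. sG ((a n \<circ> T) x) (y n)) - (S \<circ> T) x)) \<longlonglongrightarrow> 0" for x
    using rep by (simp add: represents_def)
  have le: "op_norm nE val (a n \<circ> T) * nG (y n)
      \<le> op_norm nE nH T * (op_norm nH val (a n) * nG (y n))" for n
    using mult_right_mono[OF op_norm_compose[OF E H F T a] valued_normed_space.nrm_nonneg[OF G]]
    by (simp add: mult_ac)
  show "represents val sE nE sG nG p (\<lambda>n. a n \<circ> T) y (S \<circ> T)"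
    and "(\<Sum>n. op_norm nE val (a n \<circ> T) powr p * nG (y n) powr p) powr (1 / p)
         \<le> op_norm nE nH T * (\<Sum>n. op_norm nH val (a n) powr p * nG (y n) powr p) powr (1 / p)"
    using represents_rescaled[where b = "\<lambda>n. a n \<circ> T" and z = y and B = "S \<circ> T",
        OF H G E G p op_norm_nonneg[OF E T] rep dual conv le] .
qed

lemma represents_postcompose:
  assumes E: "valued_normed_space val sE nE" and H: "valued_normed_space val sH nH"
    and G: "valued_normed_space val sG nG" and p: "0 < p"
    and S: "S \<in> bounded_operators sH nH sG nG"
    and rep: "represents val sE nE sH nH p a y T"
  shows "represents val sE nE sG nG p a (\<lambda>n. S (y n)) (S \<circ> T)"
    and "(\<Sum>n. op_norm nE val (a n) powr p * nG (S (y n)) powr p) powr (1 / p)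
         \<le> op_norm nH nG S * (\<Sum>n. op_norm nE val (a n) powr p * nH (y n) powr p) powr (1 / p)"
proof -
  interpret G: valued_normed_space val sG nG by (rule G)
  interpret S: Vector_Spaces.linear sH sG S by (rule bounded_operators_linear[OF S])
  have dual: "a n \<in> bounded_dual val sE nE" for n
    using rep by (simp add: represents_def)
  have conv: "(\<lambda>N. nG ((\<Sum>n<N. sG (a n x) (S (y n))) - (S \<circ> T) x)) \<longlonglongrightarrow> 0" for x
  proof -
    let ?d = "\<lambda>N. (\<Sum>n<N. sH (a n x) (y n)) - T x"
    have "(\<lambda>N. nH (?d N)) \<longlonglongrightarrow> 0"
      using rep by (simp add: represents_def)
    then have lim: "(\<lambda>N. op_norm nH nG S * nH (?d N)) \<longlonglongrightarrow> 0"
      by (rule tendsto_mult_right_zero)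
    have "(\<lambda>N. nG (S (?d N))) \<longlonglongrightarrow> 0"
      by (rule tendsto_sandwich[OF _ _ tendsto_const lim])
        (simp_all add: G.nrm_nonneg norm_apply_le_op_norm[OF H G S])
    then show ?thesis by (simp add: S.diff S.sum S.scale)
  qed
  have le: "op_norm nE val (a n) * nG (S (y n))
      \<le> op_norm nH nG S * (op_norm nE val (a n) * nH (y n))" for n
    using mult_left_mono[OF norm_apply_le_op_norm[OF H G S] op_norm_dual_nonneg[OF E dual]]
    by (simp add: mult_ac)
  show "represents val sE nE sG nG p a (\<lambda>n. S (y n)) (S \<circ> T)"
    and "(\<Sum>n. op_norm nE val (a n) powr p * nG (S (y n)) powr p) powr (1 / p)
         \<le> op_norm nH nG S * (\<Sum>n. op_norm nE val (a n) powr p * nH (y n) powr p) powr (1 / p)"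
    using represents_rescaled[where b = a and z = "\<lambda>n. S (y n)" and B = "S \<circ> T",
        OF E H E G p op_norm_nonneg[OF H S] rep dual conv le] .
qed

section \<open>Passing to the infimum\<close>

lemma le_mult_cInf:
  fixes X :: "real set"
  assumes "X \<noteq> {}" and "0 \<le> c" and le: "\<And>s. s \<in> X \<Longrightarrow> v \<le> c * s"
  shows "v \<le> c * Inf X"
proof (cases "c = 0")
  case True
  then show ?thesis using assms by force
next
  case False
  then have "0 < c" using assms(2) by simp
  then have "v / c \<le> Inf X"
    using assms(1) le by (intro cInf_greatest) (auto simp: divide_le_eq mult.commute)
  then show ?thesis using \<open>0 < c\<close> by (simp add: divide_le_eq mult.commute)
qed

text \<open>
  The infimum of an empty set of reals is an unspecified value, so the estimate for \<open>A\<close> relies on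
  \<open>A\<close> having a representation, which membership in \<open>L_class\<close> provides.
\<close>

lemma nu_le_if_representations_transfer:
  assumes fin: "r \<noteq> \<infinity>" and A: "A \<in> L_class r val sE nE sH nH" and c: "0 \<le> c"
    and transfer: "\<And>a y. represents val sE nE sH nH (real_of_ereal r) a y A \<Longrightarrow>
      \<exists>b z. represents val sE' nE' sH' nH' (real_of_ereal r) b z B \<and>
        (\<Sum>n. op_norm nE' val (b n) powr real_of_ereal r * nH' (z n) powr real_of_ereal r)
          powr (1 / real_of_ereal r)
        \<le> c * (\<Sum>n. op_norm nE val (a n) powr real_of_ereal r * nH (y n) powr real_of_ereal r)
          powr (1 / real_of_ereal r)"
    and B: "B \<in> bounded_operators sE' nE' sH' nH'"
  shows "B \<in> L_class r val sE' nE' sH' nH'"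
    and "nu r val sE' nE' sH' nH' B \<le> c * nu r val sE nE sH nH A"
proof -
  let ?p = "real_of_ereal r"
  let ?s = "\<lambda>a y. (\<Sum>n. op_norm nE val (a n) powr ?p * nH (y n) powr ?p) powr (1 / ?p)"
  let ?s' = "\<lambda>b z. (\<Sum>n. op_norm nE' val (b n) powr ?p * nH' (z n) powr ?p) powr (1 / ?p)"
  let ?X = "{?s a y | a y. represents val sE nE sH nH ?p a y A}"
  let ?X' = "{?s' b z | b z. represents val sE' nE' sH' nH' ?p b z B}"
  have nonempty: "\<exists>a y. represents val sE nE sH nH ?p a y A"
    using A fin by (simp add: L_class_def)
  then show "B \<in> L_class r val sE' nE' sH' nH'"
    using transfer B fin by (simp add: L_class_def) blast
  have "Inf ?X' \<le> c * Inf ?X"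
  proof (rule le_mult_cInf[OF _ c])
    show "?X \<noteq> {}" using nonempty by blast
    fix s assume "s \<in> ?X"
    then obtain b z where bz: "represents val sE' nE' sH' nH' ?p b z B" "?s' b z \<le> c * s"
      using transfer by blast
    have "bdd_below ?X'" by (rule bdd_belowI[of _ 0]) auto
    then have "Inf ?X' \<le> ?s' b z" using bz(1) by (intro cInf_lower) auto
    then show "Inf ?X' \<le> c * s" using bz(2) by linarith
  qed
  then show "nu r val sE' nE' sH' nH' B \<le> c * nu r val sE nE sH nH A"
    using fin by (simp add: nu_def)
qed

lemma L_class_subset_bounded_operators:
  "A \<in> L_class r val sE nE sH nH \<Longrightarrow> A \<in> bounded_operators sE nE sH nH"
  by (simp add: L_class_def split: if_splits)

section \<open>The ideal property\<close>

theorem proposition2p12p2: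
  fixes val :: "'f::field \<Rightarrow> real"
    and sE :: "'f \<Rightarrow> 'e::ab_group_add \<Rightarrow> 'e" and nE :: "'e \<Rightarrow> real"
    and sH :: "'f \<Rightarrow> 'h::ab_group_add \<Rightarrow> 'h" and nH :: "'h \<Rightarrow> real"
    and sG :: "'f \<Rightarrow> 'g::ab_group_add \<Rightarrow> 'g" and nG :: "'g \<Rightarrow> real"
    and r :: ereal
  assumes "infinite (UNIV :: 'f set)"
    and "nonarch_valued_field val"
    and "nontrivial_valuation val"
    and "spherically_complete val"
    and "valued_normed_space val sE nE"
    and "valued_normed_space val sH nH"
    and "valued_normed_space val sG nG"
    and "1 \<le> r"
  shows "(\<forall>T S. T \<in> bounded_operators sE nE sH nH \<longrightarrow> S \<in> L_class r val sH nH sG nG \<longrightarrow>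
            S \<circ> T \<in> L_class r val sE nE sG nG \<and>
            nu r val sE nE sG nG (S \<circ> T) \<le> nu r val sH nH sG nG S * op_norm nE nH T) \<and>
         (\<forall>T S. T \<in> L_class r val sE nE sH nH \<longrightarrow> S \<in> bounded_operators sH nH sG nG \<longrightarrow>
            S \<circ> T \<in> L_class r val sE nE sG nG \<and>
            nu r val sE nE sG nG (S \<circ> T) \<le> op_norm nH nG S * nu r val sE nE sH nH T)"
proof (cases "r = \<infinity>")
  case True
  then show ?thesis
    using bounded_operators_compose[OF assms(5-7)] op_norm_compose[OF assms(5-7)]
    by (simp add: L_class_def nu_def)
next
  case False
  note E = assms(5) and H = assms(6) and G = assms(7)
  have p: "0 < real_of_ereal r"
    using assms(8) False by (cases r) auto
  show ?thesis
  proof (intro conjI allI impI)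
    fix T S assume T: "T \<in> bounded_operators sE nE sH nH" and S: "S \<in> L_class r val sH nH sG nG"
    note ST = bounded_operators_compose[OF E H G T L_class_subset_bounded_operators[OF S]]
    note transfer = nu_le_if_representations_transfer[OF False S op_norm_nonneg[OF E T] _ ST]
    show "S \<circ> T \<in> L_class r val sE nE sG nG"
      by (rule transfer(1)) (use represents_precompose[OF E H G p T] in blast)
    have "nu r val sE nE sG nG (S \<circ> T) \<le> op_norm nE nH T * nu r val sH nH sG nG S"
      by (rule transfer(2)) (use represents_precompose[OF E H G p T] in blast)
    then show "nu r val sE nE sG nG (S \<circ> T) \<le> nu r val sH nH sG nG S * op_norm nE nH T"
      by (simp add: mult.commute)
  next
    fix T S assume T: "T \<in> L_class r val sE nE sH nH" and S: "S \<in> bounded_operators sH nH sG nG"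
    note ST = bounded_operators_compose[OF E H G L_class_subset_bounded_operators[OF T] S]
    note transfer = nu_le_if_representations_transfer[OF False T op_norm_nonneg[OF H S] _ ST]
    show "S \<circ> T \<in> L_class r val sE nE sG nG"
      by (rule transfer(1)) (use represents_postcompose[OF E H G p S] in blast)
    show "nu r val sE nE sG nG (S \<circ> T) \<le> op_norm nH nG S * nu r val sE nE sH nH T"
      by (rule transfer(2)) (use represents_postcompose[OF E H G p S] in blast)
  qed
qed

end
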